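(* For every positive integer $n \ge 4$ and every odd prime $p$, there exists a group $G$ of order $p^{n+10}$ and exponent $p^n$ such that (1) if $n = 4$, then $\gamma_2(G) = Z(G) < \Phi(G)$ and $\mathrm{Aut}(G)$ is abelian; (2) if $n \ge 5$, then $\gamma_2(G) < Z(G) < \Phi(G)$ and $\mathrm{Aut}(G)$ is abelian. Moreover, the order of $\mathrm{Aut}(G)$ is $p^{n+20}$.
   Context: For a finite group $G$, $\gamma_2(G)$, $Z(G)$ and $\Phi(G)$ denote the commutator subgroup, the center and the Frattini subgroup of $G$, respectively, and $\mathrm{Aut}(G)$ denotes the group of all automorphisms of $G$. The notation $H < K$ means that $H$ is a proper subgroup of $K$. *)

theory Defs
  imports "HOL-Algebra.Algebra"
begin

definition group_center :: "('a, 'b) monoid_scheme \<Rightarrow> 'a set" where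
  "group_center G = {z \<in> carrier G. \<forall>g \<in> carrier G. z \<otimes>\<^bsub>G\<^esub> g = g \<otimes>\<^bsub>G\<^esub> z}"

definition maximal_subgroup :: "'a set \<Rightarrow> ('a, 'b) monoid_scheme \<Rightarrow> bool" where
  "maximal_subgroup M G \<longleftrightarrow>
     subgroup M G \<and> M \<noteq> carrier G \<and>
     (\<forall>H. subgroup H G \<longrightarrow> M \<subseteq> H \<longrightarrow> H = M \<or> H = carrier G)"

text \<open>Intersecting with the carrier makes the Frattini subgroup the whole group when there are
  no maximal subgroups.\<close>

definition frattini :: "('a, 'b) monoid_scheme \<Rightarrow> 'a set" where
  "frattini G = carrier G \<inter> \<Inter> {M. maximal_subgroup M G}"

text \<open>The least-number operator is meaningful only for groups of finite exponent, in particular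
  for finite groups.\<close>

definition group_exponent :: "('a, 'b) monoid_scheme \<Rightarrow> nat" where
  "group_exponent G = (LEAST m. m > 0 \<and> (\<forall>x \<in> carrier G. x [^]\<^bsub>G\<^esub> m = \<one>\<^bsub>G\<^esub>))"

definition proper_subgroup_in :: "('a, 'b) monoid_scheme \<Rightarrow> 'a set \<Rightarrow> 'a set \<Rightarrow> bool" where
  "proper_subgroup_in G H K \<longleftrightarrow> subgroup H G \<and> subgroup K G \<and> H \<subset> K"

end

theory Submission
  imports Defs "HOL-Library.Countable" "HOL-Library.Product_Plus"
begin

text \<open>Write n = k + 4, and let A be the abelian group with generators x1, x2, x3, x4 of orders
  p^n, p^4, p^4, p^2, realised as integer quadruples modulo a lattice. Put x * y = x + y + B(x, y),
  where B is the alternating bilinear form with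
  B(x1, x2) = B(x1, x3) = B(x3, x4) = p^2 x2, B(x1, x4) = B(x2, x4) = p^2 x3 and
  B(x2, x3) = p^(n-2) x1; its values lie in its own radical. Inverses and powers are those of A, the
  commutator of x and y is 2B(x, y), and, p being odd, the automorphisms are the additive
  automorphisms f of A with f(B(x, y)) = B(f(x), f(y)). Comparing coefficients modulo p^2 in these
  six relations forces the matrix of f to be the identity modulo p^2. Hence every automorphism is
  central, id + h with h a homomorphism from the abelianization to the center, and two such h
  commute: modulo the lattice, h'(h(x)) is the first coordinate of x times the first coordinate of
  h(x1) times the first coordinate of h'(x1) times x1.\<close>

section \<open>Integer quadruples and linear maps given by their columns\<close>

type_synonym int4 = "int \<times> int \<times> int \<times> int"

fun smul :: "int \<Rightarrow> int4 \<Rightarrow> int4" where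
  "smul m (a, b, c, d) = (m * a, m * b, m * c, m * d)"

lemma smul_add_right: "smul m (x + y) = smul m x + smul m y"
  by (cases x; cases y) (simp add: algebra_simps)

lemma smul_add_left: "smul (l + m) x = smul l x + smul m x"
  by (cases x) (simp add: algebra_simps)

lemma smul_diff_right: "smul m (x - y) = smul m x - smul m y"
  by (cases x; cases y) (simp add: algebra_simps)

lemma smul_smul: "smul l (smul m x) = smul (l * m) x"
  by (cases x) (simp add: algebra_simps)

lemma smul_0 [simp]: "smul 0 x = 0"
  by (cases x) (simp add: zero_prod_def)

lemma smul_zero [simp]: "smul m 0 = 0"
  by (simp add: zero_prod_def)

lemma smul_1 [simp]: "smul 1 x = x"
  by (cases x) simp

lemma smul_2: "smul 2 x = x + x"
  by (cases x) simp

fun lin :: "int4 \<Rightarrow> int4 \<Rightarrow> int4 \<Rightarrow> int4 \<Rightarrow> int4 \<Rightarrow> int4" where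
  "lin v1 v2 v3 v4 (a, b, c, d) = smul a v1 + smul b v2 + smul c v3 + smul d v4"

lemma lin_add: "lin v1 v2 v3 v4 (x + y) = lin v1 v2 v3 v4 x + lin v1 v2 v3 v4 y"
  by (cases x; cases y) (simp add: smul_add_left algebra_simps)

text \<open>The number \<open>n\<close> inverts \<open>u\<close> modulo \<open>P\<close>. Units come
  with an explicit inverse because coordinates of preimages under an automorphism supply
  one.\<close>

lemma dvd_unit_cancel:
  fixes P :: int
  assumes "P dvd u * n - 1" and "P dvd u * x"
  shows "P dvd x"
proof -
  have "P dvd n * (u * x) - x * (u * n - 1)"
    by (rule dvd_diff; rule dvd_mult; fact assms)
  then show ?thesis by (simp add: algebra_simps)
qed

section \<open>The relation lattice, the alternating form and the group\<close>

locale odd_prime_group =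
  fixes p k :: nat
  assumes prime_p: "Factorial_Ring.prime p" and odd_p: "odd p"
begin

text \<open>With n = k + 4, the numbers p^n and p^(n-2) are \<open>P * P * q\<close> and
  \<open>P * q\<close>.\<close>

definition P :: int where "P = int p ^ 2"
definition q :: int where "q = int p ^ k"

definition lat :: "int4 set" where
  "lat = {(a, b, c, d). P * P * q dvd a \<and> P * P dvd b \<and> P * P dvd c \<and> P dvd d}"

fun bil :: "int4 \<Rightarrow> int4 \<Rightarrow> int4" where
  "bil (a, b, c, d) (a', b', c', d') =
    (P * q * (b * c' - c * b'),
     P * (a * b' - b * a' + a * c' - c * a' + c * d' - d * c'),
     P * (a * d' - d * a' + b * d' - d * b'), 0)"

fun red :: "int4 \<Rightarrow> int4" where
  "red (a, b, c, d) = (a mod (P * P * q), b mod (P * P), c mod (P * P), d mod P)"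

text \<open>A coset of \<open>lat\<close> is coded by its normal form as a natural number, since the
  theorem asks for a monoid on \<open>nat\<close>; \<open>from_nat\<close> recovers the normal
  form.\<close>

definition enc :: "int4 \<Rightarrow> nat" where "enc x = to_nat (red x)"

definition G :: "nat monoid" where
  "G = \<lparr>carrier = range enc,
        monoid.mult = (\<lambda>u v. enc (from_nat u + from_nat v + bil (from_nat u) (from_nat v))),
        one = enc 0\<rparr>"

lemma p_pos: "p > 0" and p_gt1: "p > 1"
  using prime_p prime_gt_0_nat prime_gt_1_nat by auto

lemma P_pos: "P > 0" and q_pos: "q > 0"
  using p_pos by (auto simp: P_def q_def)

lemma coprime_2_P: "coprime 2 P"
  using odd_p by (simp add: P_def)

lemma lat_iff: "(a, b, c, d) \<in> lat \<longleftrightarrow>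
    P * P * q dvd a \<and> P * P dvd b \<and> P * P dvd c \<and> P dvd d"
  by (simp add: lat_def)

lemma zero_lat [simp]: "0 \<in> lat"
  by (simp add: lat_def zero_prod_def)

lemma add_lat: "x \<in> lat \<Longrightarrow> y \<in> lat \<Longrightarrow> x + y \<in> lat"
  by (cases x; cases y) (simp add: lat_iff)

lemma minus_lat: "x \<in> lat \<Longrightarrow> - x \<in> lat"
  by (cases x) (simp add: lat_iff)

lemma diff_lat: "x \<in> lat \<Longrightarrow> y \<in> lat \<Longrightarrow> x - y \<in> lat"
  using add_lat[of x "- y"] minus_lat by simp

lemma smul_lat: "x \<in> lat \<Longrightarrow> smul m x \<in> lat"
  by (cases x) (simp add: lat_iff)

text \<open>All moduli are powers of the odd prime p, so 2 is invertible in A. This removes the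
  factor 2 from commutators and squares.\<close>

lemma smul_2_lat:
  assumes "smul 2 x \<in> lat" shows "x \<in> lat"
proof (cases x)
  case (fields a b c d)
  have "coprime (P * P * q) 2" "coprime (P * P) 2" "coprime P 2"
    using odd_p by (auto simp: P_def q_def coprime_commute)
  then show ?thesis
    using assms by (simp add: fields lat_iff coprime_dvd_mult_right_iff)
qed

lemma bil_add_left: "bil (x + x') y = bil x y + bil x' y"
  by (cases x; cases x'; cases y) (simp add: algebra_simps)

lemma bil_add_right: "bil x (y + y') = bil x y + bil x y'"
  by (cases x; cases y; cases y') (simp add: algebra_simps)

lemma bil_smul_left: "bil (smul m x) y = smul m (bil x y)"
  by (cases x; cases y) (simp add: algebra_simps)

lemma bil_swap: "bil y x = - bil x y"
  by (cases x; cases y) (simp add: algebra_simps)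

lemma bil_self [simp]: "bil x x = 0"
  by (cases x) (simp add: algebra_simps zero_prod_def)

lemma bil_0 [simp]: "bil 0 x = 0" "bil x 0 = 0"
  by (cases x; simp add: zero_prod_def)+

lemma bil_minus [simp]: "bil (- x) y = - bil x y" "bil x (- y) = - bil x y"
  by (cases x; cases y; simp add: algebra_simps)+

lemma bil_diff_left: "bil (x - x') y = bil x y - bil x' y"
  by (cases x; cases x'; cases y) (simp add: algebra_simps)

lemma bil_diff_right: "bil y (x - x') = bil y x - bil y x'"
  by (cases x; cases x'; cases y) (simp add: algebra_simps)

section \<open>The radical of the form and the span of its values\<close>

definition rad :: "int4 set" where
  "rad = {(a, b, c, d). P dvd a \<and> P dvd b \<and> P dvd c \<and> P dvd d}"

text \<open>The values of B together with \<open>lat\<close>; the last coordinate of a value is 0,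
  so there only the lattice contributes.\<close>

definition com :: "int4 set" where
  "com = {(a, b, c, d). P * q dvd a \<and> P dvd b \<and> P dvd c \<and> P dvd d}"

lemma rad_iff: "(a, b, c, d) \<in> rad \<longleftrightarrow> P dvd a \<and> P dvd b \<and> P dvd c \<and> P dvd d"
  by (simp add: rad_def)

lemma com_iff: "(a, b, c, d) \<in> com \<longleftrightarrow> P * q dvd a \<and> P dvd b \<and> P dvd c \<and> P dvd d"
  by (simp add: com_def)

lemma com_rad: "x \<in> com \<Longrightarrow> x \<in> rad"
  by (cases x) (auto simp: com_iff rad_iff dest: dvd_mult_left)

lemma lat_com: "x \<in> lat \<Longrightarrow> x \<in> com"
  by (cases x) (auto simp: lat_iff com_iff mult.assoc dest: dvd_mult_left dvd_mult_right)

lemma lat_rad: "x \<in> lat \<Longrightarrow> x \<in> rad"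
  using lat_com com_rad by blast

lemma bil_com: "bil x y \<in> com"
  by (cases x; cases y) (simp add: com_iff)

text \<open>The first three coordinates of \<open>bil\<close> carry a factor \<open>P * q\<close> or
  \<open>P\<close>, and an argument in \<open>rad\<close> adds another \<open>P\<close>, which
  completes the moduli of \<open>lat\<close>.\<close>

lemma bil_rad_lat:
  assumes "x \<in> rad" shows "bil x y \<in> lat"
proof (cases x)
  case (fields a b c d)
  obtain a' b' c' d' where y: "y = (a', b', c', d')" by (cases y)
  have "P dvd a" "P dvd b" "P dvd c" "P dvd d"
    using assms by (auto simp: fields rad_iff)
  then show ?thesis
    by (auto elim!: dvdE simp: fields y lat_iff algebra_simps)
qed

lemma bil_rad_lat': "x \<in> rad \<Longrightarrow> bil y x \<in> lat"
  using bil_rad_lat bil_swap minus_lat by metis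

section \<open>The group law on cosets of the lattice\<close>

lemma enc_eq_iff: "enc x = enc y \<longleftrightarrow> x - y \<in> lat"
  by (cases x; cases y) (simp add: enc_def lat_iff mod_eq_dvd_iff)

lemma enc_eqI: "x - y \<in> lat \<Longrightarrow> enc x = enc y"
  by (simp add: enc_eq_iff)

lemma enc_eq_0_iff: "enc x = enc 0 \<longleftrightarrow> x \<in> lat"
  by (simp add: enc_eq_iff)

lemma carrier_G: "carrier G = range enc"
  by (simp add: G_def)

lemma enc_carrier [simp]: "enc x \<in> carrier G"
  by (simp add: carrier_G)

lemma one_G: "\<one>\<^bsub>G\<^esub> = enc 0"
  by (simp add: G_def)

lemma red_diff_lat: "red x - x \<in> lat"
  by (cases x) (simp add: lat_iff flip: mod_eq_dvd_iff)

lemma mult_enc: "enc x \<otimes>\<^bsub>G\<^esub> enc y = enc (x + y + bil x y)"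
proof -
  have "enc x \<otimes>\<^bsub>G\<^esub> enc y = enc (red x + red y + bil (red x) (red y))"
    by (simp add: G_def enc_def)
  also have "\<dots> = enc (x + y + bil x y)"
  proof (rule enc_eqI)
    \<comment> \<open>A change of representatives alters the form only by values with an argument in
      \<open>lat\<close>, hence in \<open>rad\<close>, so the product is well defined.\<close>
    have "red x + red y + bil (red x) (red y) - (x + y + bil x y)
        = (red x - x) + (red y - y) + bil (red x - x) (red y) + bil x (red y - y)"
      by (simp add: bil_diff_left bil_diff_right)
    also have "\<dots> \<in> lat"
      by (intro add_lat bil_rad_lat bil_rad_lat' lat_rad red_diff_lat)
    finally show "red x + red y + bil (red x) (red y) - (x + y + bil x y) \<in> lat" .
  qed
  finally show ?thesis .
qed

lemma enc_exhaust:
  assumes "u \<in> carrier G" obtains x where "u = enc x"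
  using assms by (auto simp: carrier_G)

lemma group_G: "group G"
proof (rule groupI)
  fix u v w assume "u \<in> carrier G" "v \<in> carrier G" "w \<in> carrier G"
  then obtain x y z where xyz: "u = enc x" "v = enc y" "w = enc z"
    by (auto simp: carrier_G)
  \<comment> \<open>The two bracketings differ only in the nested values, which vanish because
    values of B lie in the radical.\<close>
  have "(x + y + bil x y) + z + bil (x + y + bil x y) z
      - (x + (y + z + bil y z) + bil x (y + z + bil y z)) = bil (bil x y) z - bil x (bil y z)"
    by (simp add: bil_add_left bil_add_right)
  also have "\<dots> \<in> lat"
    by (intro diff_lat bil_rad_lat bil_rad_lat' com_rad bil_com)
  finally show "u \<otimes>\<^bsub>G\<^esub> v \<otimes>\<^bsub>G\<^esub> w = u \<otimes>\<^bsub>G\<^esub> (v \<otimes>\<^bsub>G\<^esub> w)"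
    by (simp add: xyz mult_enc enc_eq_iff)
next
  fix u assume "u \<in> carrier G"
  then obtain x where "u = enc x" by (rule enc_exhaust)
  then have "enc (- x) \<otimes>\<^bsub>G\<^esub> u = \<one>\<^bsub>G\<^esub>"
    by (simp add: mult_enc one_G)
  then show "\<exists>v\<in>carrier G. v \<otimes>\<^bsub>G\<^esub> u = \<one>\<^bsub>G\<^esub>" by force
qed (auto simp: mult_enc one_G carrier_G)

sublocale group G by (rule group_G)

lemma inv_enc: "inv\<^bsub>G\<^esub> enc x = enc (- x)"
  by (rule inv_equality) (auto simp: mult_enc one_G)

lemma pow_enc: "enc x [^]\<^bsub>G\<^esub> (m::nat) = enc (smul (int m) x)"
proof (induction m)
  case (Suc m)
  have "smul (int (Suc m)) x = smul (int m) x + x"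
    by (cases x) (simp add: algebra_simps)
  then show ?case
    using Suc by (simp add: mult_enc bil_smul_left)
qed (simp add: one_G)

lemma commutator_enc:
  "enc x \<otimes>\<^bsub>G\<^esub> enc y \<otimes>\<^bsub>G\<^esub> inv\<^bsub>G\<^esub> enc x \<otimes>\<^bsub>G\<^esub> inv\<^bsub>G\<^esub> enc y = enc (smul 2 (bil x y))"
proof -
  define b where "b = bil x y"
  have r: "b \<in> rad" by (simp add: b_def bil_com com_rad)
  have "enc x \<otimes>\<^bsub>G\<^esub> enc y \<otimes>\<^bsub>G\<^esub> inv\<^bsub>G\<^esub> enc x \<otimes>\<^bsub>G\<^esub> inv\<^bsub>G\<^esub> enc y
      = enc (smul 2 b + (bil (bil b x) y - bil b x - bil b y - bil b y))"
    by (simp add: inv_enc mult_enc bil_add_left bil_swap[of y x] bil_diff_left smul_2 algebra_simps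
        flip: b_def)
  also have "\<dots> = enc (smul 2 b)"
  proof (rule enc_eqI)
    have "bil (bil b x) y - bil b x - bil b y - bil b y \<in> lat"
      using r by (intro diff_lat bil_rad_lat[OF com_rad[OF bil_com]] bil_rad_lat)
    then show "smul 2 b + (bil (bil b x) y - bil b x - bil b y - bil b y) - smul 2 b \<in> lat"
      by simp
  qed
  finally show ?thesis by (simp add: b_def)
qed

section \<open>Order and exponent\<close>

lemma order_G: "order G = p ^ (k + 14)"
proof -
  let ?S = "{0..<P * P * q} \<times> {0..<P * P} \<times> {0..<P * P} \<times> {0..<P}"
  \<comment> \<open>A quadruple in the box is its own normal form, so the box is a full set of coset
    representatives.\<close>
  have "range red = ?S"
  proof
    show "range red \<subseteq> ?S" using P_pos q_pos by auto
    show "?S \<subseteq> range red"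
    proof
      fix x assume "x \<in> ?S"
      then have "red x = x" by auto
      then show "x \<in> range red" by (metis rangeI)
    qed
  qed
  moreover have "range enc = to_nat ` range red"
    by (force simp: enc_def)
  ultimately have "card (range enc) = card ?S"
    by (simp add: card_image)
  also have "\<dots> = nat (P * P * q) * (nat (P * P) * (nat (P * P) * nat P))"
    by (simp add: card_cartesian_product)
  also have "\<dots> = nat (P ^ 7 * q)"
    using P_pos q_pos by (simp add: eval_nat_numeral algebra_simps flip: nat_mult_distrib)
  also have "P ^ 7 * q = int (p ^ (k + 14))"
    by (simp add: P_def q_def power_add flip: power_mult)
  finally show ?thesis by (simp add: order_def carrier_G del: of_nat_power)
qed

lemma finite_G: "finite (carrier G)"
  using order_G p_pos by (metis card.infinite not_gr_zero order_def zero_less_power)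

lemma exponent_G: "group_exponent G = p ^ (k + 4)"
  unfolding group_exponent_def
proof (rule Least_equality)
  have PPq: "P * P * q = int (p ^ (k + 4))"
    by (simp add: P_def q_def power_add flip: power_mult)
  have "smul (P * P * q) x \<in> lat" for x
    by (cases x) (simp add: lat_iff mult.assoc)
  then have "enc x [^]\<^bsub>G\<^esub> (p ^ (k + 4)) = \<one>\<^bsub>G\<^esub>" for x
    by (simp only: PPq pow_enc one_G enc_eq_0_iff)
  then show "p ^ (k + 4) > 0 \<and> (\<forall>x\<in>carrier G. x [^]\<^bsub>G\<^esub> (p ^ (k + 4)) = \<one>\<^bsub>G\<^esub>)"
    using p_pos by (simp add: carrier_G)
  \<comment> \<open>For minimality it is enough to test the first generator, whose order is
    p^n.\<close>
  fix m :: nat assume m: "m > 0 \<and> (\<forall>x\<in>carrier G. x [^]\<^bsub>G\<^esub> m = \<one>\<^bsub>G\<^esub>)"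
  then have "enc (1, 0, 0, 0) [^]\<^bsub>G\<^esub> m = \<one>\<^bsub>G\<^esub>" by simp
  then have "P * P * q dvd int m"
    by (simp only: pow_enc one_G enc_eq_0_iff smul.simps lat_iff) simp
  then have "p ^ (k + 4) dvd m" by (simp add: PPq del: of_nat_power)
  then show "p ^ (k + 4) \<le> m" using m by (auto dest: dvd_imp_le)
qed

section \<open>Center and commutator subgroup\<close>

lemma center_iff: "enc x \<in> group_center G \<longleftrightarrow> x \<in> rad"
proof
  assume "x \<in> rad"
  then show "enc x \<in> group_center G"
    by (auto simp: group_center_def carrier_G mult_enc enc_eq_iff bil_rad_lat bil_rad_lat' diff_lat)
next
  assume c: "enc x \<in> group_center G"
  \<comment> \<open>Commuting means that 2B(x, y) lies in \<open>lat\<close>, and the 2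
    cancels.\<close>
  have b: "bil x y \<in> lat" for y
  proof -
    have "enc x \<otimes>\<^bsub>G\<^esub> enc y = enc y \<otimes>\<^bsub>G\<^esub> enc x"
      using c by (simp add: group_center_def)
    then have "x + y + bil x y - (y + x + bil y x) \<in> lat"
      by (simp only: mult_enc enc_eq_iff)
    then have "smul 2 (bil x y) \<in> lat"
      by (simp add: smul_2 bil_swap[of x y])
    then show ?thesis by (rule smul_2_lat)
  qed
  obtain a b c d where x: "x = (a, b, c, d)" by (cases x)
  have P: "P \<noteq> 0" "q \<noteq> 0" using P_pos q_pos by auto
  \<comment> \<open>Pairing with the second generator isolates c, a and d; pairing with the first
    gives b + c.\<close>
  have "P * q * P dvd P * q * (- c)" "P * P dvd P * a" "P * P dvd P * (- d)" "P * P dvd P * (- b - c)"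
    using b[of "(0, 1, 0, 0)"] b[of "(1, 0, 0, 0)"] by (simp_all add: x lat_iff algebra_simps)
  then have "P dvd c" "P dvd a" "P dvd d" "P dvd - b - c"
    using P unfolding dvd_times_left_cancel_iff by auto
  moreover from this have "P dvd b" by (metis diff_minus_eq_add dvd_add dvd_minus_iff minus_diff_eq diff_add_cancel)
  ultimately show "x \<in> rad" by (simp add: x rad_iff)
qed

lemma group_center_eq: "group_center G = enc ` rad"
proof -
  have "group_center G \<subseteq> range enc"
    by (auto simp: group_center_def carrier_G)
  then show ?thesis using center_iff by blast
qed

text \<open>Commutators are the elements 2B(x, y); conversely, every element coming from
  \<open>com\<close> is a single commutator with the second generator.\<close>

lemma derived_eq: "derived G (carrier G) = enc ` com"
proof
  have "subgroup (enc ` com) G"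
  proof
    show "enc ` com \<subseteq> carrier G" by auto
    show "\<one>\<^bsub>G\<^esub> \<in> enc ` com" by (auto simp: one_G intro!: imageI lat_com)
    fix u assume "u \<in> enc ` com"
    then obtain x where x: "u = enc x" "x \<in> com" by auto
    then have "- x \<in> com" by (cases x) (simp add: com_iff)
    with x show "inv\<^bsub>G\<^esub> u \<in> enc ` com" by (auto simp: inv_enc)
    fix v assume "v \<in> enc ` com"
    then obtain y where y: "v = enc y" "y \<in> com" by auto
    then have "x + y \<in> com" using x by (cases x; cases y) (simp add: com_iff)
    then have "x + y + bil x y \<in> com" using bil_com[of x y]
      by (cases "x + y"; cases "bil x y") (simp add: com_iff)
    with x y show "u \<otimes>\<^bsub>G\<^esub> v \<in> enc ` com" by (auto simp: mult_enc)
  qed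
  moreover have "derived_set G (carrier G) \<subseteq> enc ` com"
  proof -
    have "smul 2 (bil x y) \<in> com" for x y
      using bil_com[of x y] by (cases "bil x y") (simp add: com_iff)
    then show ?thesis by (auto simp only: carrier_G commutator_enc image_iff)
  qed
  ultimately show "derived G (carrier G) \<subseteq> enc ` com"
    unfolding derived_def by (rule generate_subgroup_incl[rotated])
next
  show "enc ` com \<subseteq> derived G (carrier G)"
  proof
    fix u assume "u \<in> enc ` com"
    then obtain x where "u = enc x" "x \<in> com" by auto
    moreover obtain a' b' c' d' where "x = (a', b', c', d')" by (cases x)
    moreover from calculation have "P * q dvd a'" "P dvd b'" "P dvd c'" "P dvd d'"
      by (simp_all add: com_iff)
    then obtain a b c d where "a' = P * q * a" "b' = P * b" "c' = P * c" "d' = P * d"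
      by (elim dvdE)
    ultimately have u: "u = enc (P * q * a, P * b, P * c, P * d)" by simp
    obtain s t where st: "1 = 2 * s + P * t"
      using bezout_int[of 2 P] coprime_2_P by (auto simp: algebra_simps)
    \<comment> \<open>B(x2, (-b, 0, a, c)) is (P q a, P b, P c, 0), and s, the inverse of 2 modulo
      \<open>P\<close>, cancels the 2 of the commutator. The remaining coordinate
      \<open>P * d\<close> is absorbed by \<open>lat\<close>.\<close>
    let ?y = "smul s (- b, 0, a, c)"
    have "(P * q * a, P * b, P * c, P * d) - smul 2 (bil (0, 1, 0, 0) ?y)
        = (P * q * a * (1 - 2 * s), P * b * (1 - 2 * s), P * c * (1 - 2 * s), P * d)"
      by (simp add: algebra_simps)
    also have "1 - 2 * s = P * t" using st by simp
    also have "(P * q * a * (P * t), P * b * (P * t), P * c * (P * t), P * d) \<in> lat"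
      by (simp add: lat_iff algebra_simps)
    finally have "u = enc (0, 1, 0, 0) \<otimes>\<^bsub>G\<^esub> enc ?y \<otimes>\<^bsub>G\<^esub> inv\<^bsub>G\<^esub> enc (0, 1, 0, 0) \<otimes>\<^bsub>G\<^esub> inv\<^bsub>G\<^esub> enc ?y"
      unfolding commutator_enc u by (rule enc_eqI)
    then have "u \<in> derived_set G (carrier G)"
      using UN_I[OF enc_carrier[of "(0, 1, 0, 0)"] UN_I[OF enc_carrier[of ?y] singletonI]]
      by (simp only:)
    then show "u \<in> derived G (carrier G)"
      unfolding derived_def by (rule generate.incl)
  qed
qed


subsection \<open>The Frattini subgroup\<close>

lemma subgroup_encI:
  assumes "0 \<in> K" and "\<And>x. x \<in> K \<Longrightarrow> - x \<in> K"
    and "\<And>x y. x \<in> K \<Longrightarrow> y \<in> K \<Longrightarrow> enc (x + y + bil x y) \<in> enc ` K"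
  shows "subgroup (enc ` K) G"
proof
  show "enc ` K \<subseteq> carrier G" by auto
  show "\<one>\<^bsub>G\<^esub> \<in> enc ` K" using assms(1) by (simp add: one_G)
  show "inv\<^bsub>G\<^esub> u \<in> enc ` K" if "u \<in> enc ` K" for u
    using that assms(2) by (auto simp: inv_enc)
  show "u \<otimes>\<^bsub>G\<^esub> v \<in> enc ` K" if "u \<in> enc ` K" "v \<in> enc ` K" for u v
    using that assms(3) by (auto simp: mult_enc)
qed

lemma com_add: "x \<in> com \<Longrightarrow> y \<in> com \<Longrightarrow> x + y \<in> com"
  by (cases x; cases y) (simp add: com_iff)

lemma com_minus: "x \<in> com \<Longrightarrow> - x \<in> com"
  by (cases x) (simp add: com_iff)

lemma rad_add: "x \<in> rad \<Longrightarrow> y \<in> rad \<Longrightarrow> x + y \<in> rad"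
  by (cases x; cases y) (simp add: rad_iff)

lemma rad_minus: "x \<in> rad \<Longrightarrow> - x \<in> rad"
  by (cases x) (simp add: rad_iff)

lemma subgroup_center: "subgroup (group_center G) G"
  unfolding group_center_eq
  by (rule subgroup_encI) (rule lat_rad[OF zero_lat] rad_minus imageI rad_add com_rad[OF bil_com] | assumption)+

text \<open>By maximality, the product of \<open>M\<close> and the commutator subgroup is
  \<open>M\<close> or the whole group. In the second case, \<open>com\<close> being central, every
  commutator is already one of elements of \<open>M\<close>.\<close>

lemma maximal_contains_com:
  assumes M: "maximal_subgroup M G" and z: "z \<in> com"
  shows "enc z \<in> M"
proof -
  interpret M: subgroup M G using M by (simp add: maximal_subgroup_def)
  let ?K = "{x + c | x c. enc x \<in> M \<and> c \<in> com}"
  have sub: "subgroup (enc ` ?K) G"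
  proof (rule subgroup_encI)
    have "0 = 0 + (0 :: int4)" "enc 0 \<in> M"
      using M.one_closed by (simp_all add: one_G)
    then show "0 \<in> ?K" using lat_com[OF zero_lat] by blast
    show "- u \<in> ?K" if u: "u \<in> ?K" for u
    proof -
      obtain x c where "u = x + c" "enc x \<in> M" "c \<in> com" using u by auto
      then have "- u = - x + - c" "enc (- x) \<in> M" "- c \<in> com"
        using M.m_inv_closed[of "enc x"] by (auto simp: inv_enc com_minus)
      then show ?thesis by blast
    qed
    show "enc (u + v + bil u v) \<in> enc ` ?K" if uv: "u \<in> ?K" "v \<in> ?K" for u v
    proof -
      obtain x c y d where "u = x + c" "enc x \<in> M" "c \<in> com" "v = y + d" "enc y \<in> M" "d \<in> com"
        using uv by blast
      then have "u + v + bil u v = (x + y + bil x y) + (c + d + (bil x d + bil c v))"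
        and "enc (x + y + bil x y) \<in> M" and "c + d + (bil x d + bil c v) \<in> com"
        using M.m_closed[of "enc x" "enc y"]
        by (auto simp: mult_enc bil_add_left bil_add_right com_add bil_com algebra_simps)
      then show ?thesis by blast
    qed
  qed
  have "M \<subseteq> enc ` ?K"
  proof
    fix u assume u: "u \<in> M"
    then obtain x where x: "u = enc x" by (meson M.mem_carrier enc_exhaust)
    have "x = x + 0" by simp
    then show "u \<in> enc ` ?K" using u x lat_com[OF zero_lat] by blast
  qed
  with sub M have "enc ` ?K = M \<or> enc ` ?K = carrier G"
    by (simp add: maximal_subgroup_def)
  then show ?thesis
  proof
    assume *: "enc ` ?K = M"
    have "z = 0 + z" by simp
    moreover have "enc 0 \<in> M" using M.one_closed by (simp add: one_G)
    ultimately have "z \<in> ?K" using z by blast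
    then have "enc z \<in> enc ` ?K" by (rule imageI)
    then show ?thesis by (simp only: *)
  next
    assume full: "enc ` ?K = carrier G"
    have rep: "\<exists>x. enc x \<in> M \<and> u - x \<in> com" for u
    proof -
      have "enc u \<in> enc ` ?K" by (simp only: full enc_carrier)
      then obtain x c where xc: "enc u = enc (x + c)" "enc x \<in> M" "c \<in> com" by blast
      then have "(u - (x + c)) + c \<in> com"
        by (simp only: enc_eq_iff com_add lat_com)
      then have "u - x \<in> com" by simp
      then show ?thesis using xc by blast
    qed
    have "enc u \<otimes>\<^bsub>G\<^esub> enc v \<otimes>\<^bsub>G\<^esub> inv\<^bsub>G\<^esub> enc u \<otimes>\<^bsub>G\<^esub> inv\<^bsub>G\<^esub> enc v \<in> M" for u v
    proof -
      obtain x y where x: "enc x \<in> M" "u - x \<in> com" and y: "enc y \<in> M" "v - y \<in> com"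
        using rep by meson
      have "bil u v - bil x y = bil (u - x) v + bil x (v - y)"
        by (simp add: bil_diff_left bil_diff_right)
      also have "\<dots> \<in> lat"
        using x y by (intro add_lat bil_rad_lat bil_rad_lat' com_rad)
      finally have "enc (smul 2 (bil u v)) = enc (smul 2 (bil x y))"
        by (intro enc_eqI) (metis smul_diff_right smul_lat)
      then have "enc u \<otimes>\<^bsub>G\<^esub> enc v \<otimes>\<^bsub>G\<^esub> inv\<^bsub>G\<^esub> enc u \<otimes>\<^bsub>G\<^esub> inv\<^bsub>G\<^esub> enc v
          = enc x \<otimes>\<^bsub>G\<^esub> enc y \<otimes>\<^bsub>G\<^esub> inv\<^bsub>G\<^esub> enc x \<otimes>\<^bsub>G\<^esub> inv\<^bsub>G\<^esub> enc y"
        by (simp only: commutator_enc)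
      also have "\<dots> \<in> M" using x y by (intro M.m_closed M.m_inv_closed)
      finally show ?thesis .
    qed
    then have "derived_set G (carrier G) \<subseteq> M" by (auto simp only: carrier_G)
    then have "derived G (carrier G) \<subseteq> M"
      unfolding derived_def by (rule generate_subgroup_incl) (rule M.subgroup_axioms)
    then show ?thesis using z by (auto simp: derived_eq)
  qed
qed

text \<open>Since \<open>M\<close> contains the commutator subgroup, it is closed under addition,
  and M + pA is a subgroup. If M + pA = A, iteration gives M + p^j A = A for all j, and p^n A = 0
  then yields M = A.\<close>

lemma maximal_contains_smul_p:
  assumes M: "maximal_subgroup M G"
  shows "enc (smul (int p) z) \<in> M"
proof -
  interpret M: subgroup M G using M by (simp add: maximal_subgroup_def)
  have add: "enc (x + y) \<in> M" if xy: "enc x \<in> M" "enc y \<in> M" for x y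
  proof -
    \<comment> \<open>The factor \<open>enc (- bil x y)\<close>, which lies in \<open>M\<close>,
      turns the product into the sum.\<close>
    have "enc x \<otimes>\<^bsub>G\<^esub> enc y \<otimes>\<^bsub>G\<^esub> enc (- bil x y) \<in> M"
      using xy by (intro M.m_closed maximal_contains_com[OF M com_minus[OF bil_com]])
    also have "enc x \<otimes>\<^bsub>G\<^esub> enc y \<otimes>\<^bsub>G\<^esub> enc (- bil x y) = enc (x + y)"
      unfolding mult_enc
    proof (rule enc_eqI)
      have "x + y + bil x y + - bil x y + bil (x + y + bil x y) (- bil x y) - (x + y)
          = - bil (x + y + bil x y) (bil x y)" by simp
      also have "\<dots> \<in> lat" by (intro minus_lat bil_rad_lat' com_rad bil_com)
      finally show "x + y + bil x y + - bil x y + bil (x + y + bil x y) (- bil x y) - (x + y) \<in> lat" .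
    qed
    finally show ?thesis .
  qed
  have minus: "enc (- x) \<in> M" if "enc x \<in> M" for x
    using M.m_inv_closed[OF that] by (simp add: inv_enc)
  have zero: "enc 0 \<in> M" using M.one_closed by (simp add: one_G)
  have smul: "enc (smul (int m) x) \<in> M" if "enc x \<in> M" for x m
    using that by (induction m) (simp_all add: zero smul_add_left add)
  let ?K = "{x + smul (int p) y | x y. enc x \<in> M}"
  have "subgroup (enc ` ?K) G"
  proof (rule subgroup_encI)
    have "0 = 0 + smul (int p) 0" by simp
    then show "0 \<in> ?K" using zero by blast
    show "- u \<in> ?K" if u: "u \<in> ?K" for u
    proof -
      obtain x y where "u = x + smul (int p) y" "enc x \<in> M" using u by auto
      then have "- u = - x + smul (int p) (- y)" "enc (- x) \<in> M"
        using minus smul_diff_right[of "int p" 0 y] by auto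
      then show ?thesis by blast
    qed
    show "enc (u + v + bil u v) \<in> enc ` ?K" if uv: "u \<in> ?K" "v \<in> ?K" for u v
    proof -
      obtain x y x' y' where "u = x + smul (int p) y" "enc x \<in> M"
          and "v = x' + smul (int p) y'" "enc x' \<in> M"
        using uv by blast
      then have "u + v + bil u v = (x + x' + bil u v) + smul (int p) (y + y')"
        and "enc (x + x' + bil u v) \<in> M"
        by (auto simp: smul_add_right intro!: add maximal_contains_com[OF M bil_com])
      then show ?thesis by blast
    qed
  qed
  moreover have "M \<subseteq> enc ` ?K"
  proof
    fix u assume u: "u \<in> M"
    then obtain x where x: "u = enc x" by (meson M.mem_carrier enc_exhaust)
    have "x = x + smul (int p) 0" by simp
    then show "u \<in> enc ` ?K" using u x by blast
  qed
  ultimately have "enc ` ?K = M \<or> enc ` ?K = carrier G"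
    using M by (simp add: maximal_subgroup_def)
  then show ?thesis
  proof
    assume *: "enc ` ?K = M"
    have "smul (int p) z = 0 + smul (int p) z" by simp
    then have "smul (int p) z \<in> ?K" using zero by blast
    then have "enc (smul (int p) z) \<in> enc ` ?K" by (rule imageI)
    then show ?thesis by (simp only: *)
  next
    assume full: "enc ` ?K = carrier G"
    have step: "\<exists>x y. u = x + smul (int p) y \<and> enc x \<in> M" for u
    proof -
      have "enc u \<in> enc ` ?K" by (simp only: full enc_carrier)
      then obtain x y where xy: "enc u = enc (x + smul (int p) y)" "enc x \<in> M" by blast
      then have "u - smul (int p) y - x \<in> lat" by (simp add: enc_eq_iff algebra_simps)
      then have "enc (u - smul (int p) y) \<in> M" using xy by (simp flip: enc_eq_iff)
      moreover have "u = (u - smul (int p) y) + smul (int p) y" by simp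
      ultimately show ?thesis by blast
    qed
    have iter: "\<exists>x y. u = x + smul (int (p ^ j)) y \<and> enc x \<in> M" for j u
    proof (induction j)
      case 0
      have "u = 0 + smul (int (p ^ 0)) u" by simp
      then show ?case using zero by blast
    next
      case (Suc j)
      then obtain x y where "u = x + smul (int (p ^ j)) y" "enc x \<in> M" by blast
      moreover obtain x' y' where "y = x' + smul (int p) y'" "enc x' \<in> M" using step by blast
      ultimately have "u = (x + smul (int (p ^ j)) x') + smul (int (p ^ Suc j)) y'"
          and "enc (x + smul (int (p ^ j)) x') \<in> M"
        by (simp_all add: smul_add_right smul_smul mult.commute add.assoc add smul del: of_nat_power)
      then show ?case by blast
    qed
    have "enc u \<in> M" for u
    proof -
      obtain x y where u: "u = x + smul (int (p ^ (k + 4))) y" and x: "enc x \<in> M"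
        using iter by blast
      have "int (p ^ (k + 4)) = P * P * q"
        by (simp add: P_def q_def power_add flip: power_mult)
      then have "smul (int (p ^ (k + 4))) y \<in> lat"
        by (cases y) (simp add: lat_iff mult.assoc)
      then have "enc u = enc x" by (simp add: u enc_eq_iff)
      with x show ?thesis by simp
    qed
    then show ?thesis .
  qed
qed

lemma subgroup_frattini: "subgroup (frattini G) G"
proof -
  \<comment> \<open>Inserting the carrier makes the family nonempty, as the intersection lemma for
    subgroups requires.\<close>
  have "frattini G = \<Inter> (insert (carrier G) {M. maximal_subgroup M G})"
    by (simp add: frattini_def)
  also have "subgroup \<dots> G"
    by (rule subgroups_Inter) (auto simp: maximal_subgroup_def subgroup_self)
  finally show ?thesis .
qed

lemma smul_p_frattini: "enc (smul (int p) z) \<in> frattini G"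
  by (simp add: frattini_def maximal_contains_smul_p)

text \<open>The center is p^2 A, which lies in pA and hence in every maximal subgroup. The element p
  x1 separates the two, since p^2 does not divide p.\<close>

lemma center_frattini: "proper_subgroup_in G (group_center G) (frattini G)"
  unfolding proper_subgroup_in_def
proof (intro conjI subgroup_center subgroup_frattini psubsetI)
  show "group_center G \<subseteq> frattini G"
  proof
    fix u assume "u \<in> group_center G"
    then obtain x where x: "u = enc x" "x \<in> rad" by (auto simp: group_center_eq)
    obtain a b c d where abcd: "x = (a, b, c, d)" by (cases x)
    have "int p dvd a" "int p dvd b" "int p dvd c" "int p dvd d"
      using x(2) by (auto simp: abcd rad_iff P_def power2_eq_square dest: dvd_mult_left)
    then obtain a' b' c' d' where "a = int p * a'" "b = int p * b'" "c = int p * c'" "d = int p * d'"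
      by (elim dvdE)
    then have "x = smul (int p) (a', b', c', d')" by (simp add: abcd)
    then show "u \<in> frattini G" by (simp only: x(1) smul_p_frattini)
  qed
  have "\<not> P dvd int p"
    using p_gt1 by (auto simp: P_def power2_eq_square)
  then have "enc (smul (int p) (1, 0, 0, 0)) \<notin> group_center G"
    by (simp add: center_iff rad_iff)
  then show "group_center G \<noteq> frattini G"
    using smul_p_frattini by metis
qed

text \<open>Here q = 1, so \<open>com\<close> and \<open>rad\<close> coincide.\<close>

lemma derived_eq_center: "k = 0 \<Longrightarrow> derived G (carrier G) = group_center G"
  unfolding derived_eq group_center_eq com_def rad_def q_def by (simp only: power_0 mult_1_right)

text \<open>The element p^2 x1 is central, but first coordinates in \<open>com\<close> are divisible
  by p^2 q, and now q > 1.\<close>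

lemma derived_center:
  assumes "k > 0"
  shows "proper_subgroup_in G (derived G (carrier G)) (group_center G)"
  unfolding proper_subgroup_in_def
proof (intro conjI subgroup_center derived_is_subgroup order_refl psubsetI)
  show "derived G (carrier G) \<subseteq> group_center G"
    by (auto simp: derived_eq group_center_eq com_rad)
  have "\<not> P * q dvd P"
  proof
    assume "P * q dvd P"
    then have "q dvd 1" using P_pos by (simp add: dvd_times_left_cancel_iff[of P q 1, simplified])
    then show False using one_less_power[of "int p" k] p_gt1 assms q_pos by (simp add: q_def)
  qed
  have "enc (P, 0, 0, 0) \<in> group_center G" by (simp add: center_iff rad_iff)
  moreover have "enc (P, 0, 0, 0) \<notin> derived G (carrier G)"
  proof
    assume "enc (P, 0, 0, 0) \<in> derived G (carrier G)"
    then obtain x where x: "x \<in> com" "(P, 0, 0, 0) - x \<in> lat"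
      by (auto simp: derived_eq enc_eq_iff)
    from com_add[OF lat_com[OF x(2)] x(1)] have "(P, 0, 0, 0) \<in> com" by simp
    with \<open>\<not> P * q dvd P\<close> show False by (simp add: com_iff)
  qed
  ultimately show "derived G (carrier G) \<noteq> group_center G" by metis
qed


subsection \<open>Rigidity of automorphisms\<close>

text \<open>Addition can be recovered from the group law: the product of x * y and y * x, and the
  square of x + y, are both 2(x + y), and 2 is invertible.\<close>

lemma hom_enc_add:
  assumes f: "f \<in> hom G G" and x: "f (enc x) = enc x'" and y: "f (enc y) = enc y'"
  shows "f (enc (x + y)) = enc (x' + y')"
proof -
  have sq: "enc u \<otimes>\<^bsub>G\<^esub> enc v \<otimes>\<^bsub>G\<^esub> (enc v \<otimes>\<^bsub>G\<^esub> enc u) = enc (smul 2 (u + v))" for u v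
  proof -
    define s b where "s = u + v" and "b = bil u v"
    have sb: "u + v + bil u v = s + b" "v + u + bil v u = s - b"
      by (simp_all add: s_def b_def bil_swap[of u v])
    have "s + b + (s - b) + bil (s + b) (s - b) - smul 2 s = smul 2 (bil b s)"
      by (simp add: smul_2 bil_add_left bil_diff_right bil_swap[of s b])
    also have "\<dots> \<in> lat"
      unfolding b_def by (intro smul_lat bil_rad_lat com_rad bil_com)
    finally show ?thesis
      unfolding mult_enc sb by (simp add: enc_eq_iff flip: s_def)
  qed
  obtain z where z: "f (enc (x + y)) = enc z"
    using f by (meson enc_carrier enc_exhaust hom_in_carrier)
  have "enc (smul 2 z) = enc z \<otimes>\<^bsub>G\<^esub> enc z"
    by (simp add: mult_enc smul_2)
  also have "\<dots> = f (enc (x + y) \<otimes>\<^bsub>G\<^esub> enc (x + y))"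
    by (simp add: hom_mult[OF f] z)
  also have "enc (x + y) \<otimes>\<^bsub>G\<^esub> enc (x + y) = enc x \<otimes>\<^bsub>G\<^esub> enc y \<otimes>\<^bsub>G\<^esub> (enc y \<otimes>\<^bsub>G\<^esub> enc x)"
    unfolding sq by (simp add: mult_enc smul_2)
  also have "f \<dots> = enc (smul 2 (x' + y'))"
    using sq[of x' y'] by (simp only: hom_mult[OF f] m_closed enc_carrier x y)
  finally have "smul 2 (z - (x' + y')) \<in> lat"
    by (simp only: enc_eq_iff smul_diff_right)
  then show ?thesis by (simp only: z enc_eqI smul_2_lat)
qed

lemma hom_enc_0: "f \<in> hom G G \<Longrightarrow> f (enc 0) = enc 0"
  using hom_one[OF _ group_G group_G] by (simp add: one_G)

lemma hom_enc_minus: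
  assumes f: "f \<in> hom G G" and x: "f (enc x) = enc x'"
  shows "f (enc (- x)) = enc (- x')"
proof -
  interpret group_hom G G f
    using f by unfold_locales
  show ?thesis using hom_inv[of "enc x"] by (simp add: x inv_enc)
qed

lemma hom_enc_smul:
  assumes f: "f \<in> hom G G" and x: "f (enc x) = enc x'"
  shows "f (enc (smul m x)) = enc (smul m x')"
proof -
  have pos: "f (enc (smul (int j) x)) = enc (smul (int j) x')" for j
  proof (induction j)
    case (Suc j)
    then show ?case
      using hom_enc_add[OF f Suc x] by (simp add: smul_add_left add.commute)
  qed (simp add: hom_enc_0[OF f])
  have neg: "smul (- int j) y = - smul (int j) y" for j y
    by (cases y) simp
  show ?thesis
    by (cases m rule: int_cases2) (simp_all only: pos neg hom_enc_minus[OF f pos])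
qed

text \<open>B(x, y) is x * y minus x + y, and both operations are preserved.\<close>

lemma hom_enc_bil:
  assumes f: "f \<in> hom G G" and x: "f (enc x) = enc x'" and y: "f (enc y) = enc y'"
  shows "f (enc (bil x y)) = enc (bil x' y')"
proof -
  have "f (enc (x + y + bil x y)) = enc (x' + y' + bil x' y')"
    using hom_mult[OF f enc_carrier enc_carrier, of x y] by (simp only: mult_enc x y)
  moreover have "f (enc (- (x + y))) = enc (- (x' + y'))"
    by (rule hom_enc_minus[OF f hom_enc_add[OF f x y]])
  ultimately show ?thesis
    using hom_enc_add[OF f, of "x + y + bil x y" _ "- (x + y)"] by simp
qed

lemma hom_enc_lin:
  assumes f: "f \<in> hom G G"
    and v: "f (enc (1, 0, 0, 0)) = enc v1" "f (enc (0, 1, 0, 0)) = enc v2"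
      "f (enc (0, 0, 1, 0)) = enc v3" "f (enc (0, 0, 0, 1)) = enc v4"
  shows "f (enc x) = enc (lin v1 v2 v3 v4 x)"
proof (cases x)
  case (fields a b c d)
  have "x = smul a (1, 0, 0, 0) + smul b (0, 1, 0, 0) + smul c (0, 0, 1, 0) + smul d (0, 0, 0, 1)"
    by (simp add: fields)
  then show ?thesis
    unfolding fields lin.simps by (simp only: hom_enc_add[OF f] hom_enc_smul[OF f] v)
qed

text \<open>Applied to multiples, this injectivity statement transports orders of elements in both
  directions.\<close>

lemma auto_enc_lat:
  assumes f: "f \<in> auto G" and x: "f (enc x) = enc y"
  shows "y \<in> lat \<longleftrightarrow> x \<in> lat"
proof -
  have "inj_on f (carrier G)" and f0: "f (enc 0) = enc 0"
    using f hom_enc_0 by (auto simp: auto_def Bij_def bij_betw_def)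
  then have "f (enc x) = f (enc 0) \<longleftrightarrow> enc x = enc 0"
    by (intro inj_on_eq_iff) auto
  then show ?thesis by (simp only: x f0 enc_eq_0_iff)
qed

lemma auto_enc_preimage:
  assumes f: "f \<in> auto G"
  obtains y where "f (enc y) = enc x"
proof -
  have "enc x \<in> f ` carrier G"
    using f by (simp add: auto_def Bij_def bij_betw_def)
  then show ?thesis using that by (auto simp: carrier_G)
qed

text \<open>Up to multiples of p^2, the columns of the matrix of an automorphism are (a1, b1, c1, d1),
  (q a2, b2, c2, d2), (q a3, b3, c3, d3) and (0, 0, 0, D), with q = p^(n-4) because x2 and x3 have
  order p^4; the assumption eij compares coefficients in f(B(xi, xj)) = B(f(xi), f(xj)).\<close>

lemma rigid_matrix:
  fixes P q :: int
  assumes e12: "P dvd b1 * c2 - c1 * b2 - a2"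
      "P dvd a1 * b2 - b1 * (q * a2) + a1 * c2 - c1 * (q * a2) + c1 * d2 - d1 * c2 - b2"
      "P dvd a1 * d2 - d1 * (q * a2) + b1 * d2 - d1 * b2 - c2"
    and e13: "P dvd b1 * c3 - c1 * b3 - a2"
      "P dvd a1 * b3 - b1 * (q * a3) + a1 * c3 - c1 * (q * a3) + c1 * d3 - d1 * c3 - b2"
      "P dvd a1 * d3 - d1 * (q * a3) + b1 * d3 - d1 * b3 - c2"
    and e14: "P dvd a3" "P dvd c1 * D - b3" "P dvd a1 * D + b1 * D - c3"
    and e23: "P dvd b2 * c3 - c2 * b3 - a1"
    and e24: "P dvd c2 * D - b3" "P dvd q * a2 * D + b2 * D - c3"
    and e34: "P dvd a2"
    and a1: "P dvd a1 * n1 - 1" and D: "P dvd D * nD - 1"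
    and c3: "P dvd c1 \<Longrightarrow> P dvd c2 \<Longrightarrow> P dvd c3 * n3 - 1"
  shows "P dvd a1 - 1" "P dvd b1" "P dvd c1" "P dvd d1"
    "P dvd b2 - 1" "P dvd c2" "P dvd d2"
    "P dvd b3" "P dvd c3 - 1" "P dvd d3" "P dvd D - 1"
proof -
  note intros = dvd_add dvd_diff dvd_mult
  \<comment> \<open>B(x1, x4) and B(x2, x4) are both p^2 x3, so their comparisons can be subtracted,
    and the unit D cancelled.\<close>
  have "P dvd (c1 * D - b3) - (c2 * D - b3)"
    using e14 e24 by - (assumption | rule intros)+
  then have "P dvd D * (c1 - c2)" by (simp add: algebra_simps)
  then have c12: "P dvd c1 - c2" by (rule dvd_unit_cancel[OF D])
  have "P dvd (a1 * D + b1 * D - c3) - (q * a2 * D + b2 * D - c3) + q * D * a2"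
    using e14 e24 e34 by - (assumption | rule intros)+
  then have "P dvd D * (a1 + b1 - b2)" by (simp add: algebra_simps)
  then have ab: "P dvd a1 + b1 - b2" by (rule dvd_unit_cancel[OF D])
  \<comment> \<open>With c2 = c1, b2 = a1 + b1 and a2 = 0, the first comparison for B(x1, x2) leaves
    only a1 c1.\<close>
  have "P dvd - ((b1 * c2 - c1 * b2 - a2) + a2 + b1 * (c1 - c2) - c1 * (a1 + b1 - b2))"
    unfolding dvd_minus_iff using e12 e34 c12 ab by - (assumption | rule intros)+
  then have "P dvd a1 * c1" by (simp add: algebra_simps)
  then show c1: "P dvd c1" by (rule dvd_unit_cancel[OF a1])
  have "P dvd c1 - (c1 - c2)" using c1 c12 by (rule dvd_diff)
  then show c2: "P dvd c2" by simp
  have "P dvd D * c1 - (c1 * D - b3)" using c1 e14 by - (assumption | rule intros)+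
  then show b3: "P dvd b3" by (simp add: algebra_simps)
  note c3' = c3[OF c1 c2]
  \<comment> \<open>Modulo \<open>P\<close>, D b2 equals the unit c3, so b2 is a unit as
    well.\<close>
  have b2_unit: "P dvd x" if "P dvd b2 * x" for x
  proof -
    have "P dvd D * (b2 * x) - x * (q * a2 * D + b2 * D - c3) + x * q * D * a2"
      using that e24 e34 by - (assumption | rule intros)+
    then have "P dvd c3 * x" by (simp add: algebra_simps)
    then show ?thesis by (rule dvd_unit_cancel[OF c3'])
  qed
  have "P dvd (a1 * b2 - b1 * (q * a2) + a1 * c2 - c1 * (q * a2) + c1 * d2 - d1 * c2 - b2)
      + (b1 * q + c1 * q) * a2 - (a1 - d1) * c2 - d2 * c1"
    using e12 e34 c1 c2 by - (assumption | rule intros)+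
  then have "P dvd b2 * (a1 - 1)" by (simp add: algebra_simps)
  then show a1_1: "P dvd a1 - 1" by (rule b2_unit)
  have "P dvd (a1 * d2 - d1 * (q * a2) + b1 * d2 - d1 * b2 - c2) + c2 + d1 * q * a2
      - d2 * (a1 + b1 - b2)"
    using e12 e34 c2 ab by - (assumption | rule intros)+
  then have "P dvd b2 * (d2 - d1)" by (simp add: algebra_simps)
  then have d12: "P dvd d2 - d1" by (rule b2_unit)
  have "P dvd (b1 * c3 - c1 * b3 - a2) + a2 + b3 * c1"
    using e13 e34 c1 by - (assumption | rule intros)+
  then have "P dvd c3 * b1" by (simp add: algebra_simps)
  then show b1: "P dvd b1" by (rule dvd_unit_cancel[OF c3'])
  have "P dvd (a1 - 1) + b1 - (a1 + b1 - b2)" using a1_1 b1 ab by - (assumption | rule intros)+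
  then show b2: "P dvd b2 - 1" by simp
  have "P dvd (q * a2 * D + b2 * D - c3) - q * D * a2 - D * (b2 - 1)"
    using e24 e34 b2 by - (assumption | rule intros)+
  then have Dc: "P dvd D - c3" by (simp add: algebra_simps)
  have "P dvd (b2 * c3 - c2 * b3 - a1) + b3 * c2 - c3 * (b2 - 1) + (a1 - 1)"
    using e23 c2 b2 a1_1 by - (assumption | rule intros)+
  then show c3_1: "P dvd c3 - 1" by (simp add: algebra_simps)
  have "P dvd (D - c3) + (c3 - 1)" using Dc c3_1 by (rule dvd_add)
  then show "P dvd D - 1" by simp
  \<comment> \<open>Everything else being known, the x2-coordinate of the relation for B(x1, x3)
    reduces to d1.\<close>
  have "P dvd - ((a1 * b3 - b1 * (q * a3) + a1 * c3 - c1 * (q * a3) + c1 * d3 - d1 * c3 - b2)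
      - a1 * b3 + (b1 * q + c1 * q) * a3 - d3 * c1 - (a1 - d1) * (c3 - 1) - (a1 - 1) + (b2 - 1))"
    unfolding dvd_minus_iff using e13 b3 e14 c1 c3_1 a1_1 b2 by - (assumption | rule intros)+
  then show d1: "P dvd d1" by (simp add: algebra_simps)
  have "P dvd (d2 - d1) + d1" using d12 d1 by (rule dvd_add)
  then show "P dvd d2" by simp
  have "P dvd (a1 * d3 - d1 * (q * a3) + b1 * d3 - d1 * b3 - c2) + c2 + d1 * b3 + d1 * q * a3
      - d3 * b1 - d3 * (a1 - 1)"
    using e13 e14 b3 c2 b1 a1_1 by - (assumption | rule intros)+
  then show "P dvd d3" by (simp add: algebra_simps)
qed


lemma dvd_cancel_left: "m > 0 \<Longrightarrow> m * P dvd m * x \<Longrightarrow> P dvd x" for m x :: int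
  by simp

text \<open>Preserved relations give the congruences of \<open>rigid_matrix\<close>, and preimages
  of generators give the units. Orders contribute the factor q by which \<open>com\<close> is
  smaller than \<open>rad\<close>.\<close>

lemma auto_rigid:
  assumes f: "f \<in> auto G"
    and v: "f (enc (1, 0, 0, 0)) = enc v1" "f (enc (0, 1, 0, 0)) = enc v2"
      "f (enc (0, 0, 1, 0)) = enc v3" "f (enc (0, 0, 0, 1)) = enc v4"
  shows "v1 - (1, 0, 0, 0) \<in> rad" "v2 - (0, 1, 0, 0) \<in> com"
    "v3 - (0, 0, 1, 0) \<in> com" "v4 - (0, 0, 0, 1) \<in> com"
proof -
  have h: "f \<in> hom G G" using f by (simp add: auto_def)
  have Pq: "P > 0" "q > 0" "P * q > 0" "P * P > 0" "P \<noteq> 0" using P_pos q_pos by auto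
  note L = hom_enc_lin[OF h v]
  have rel: "bil x' y' - lin v1 v2 v3 v4 (bil x y) \<in> lat"
    if "f (enc x) = enc x'" "f (enc y) = enc y'" for x y x' y'
    using hom_enc_bil[OF h that, symmetric] L[of "bil x y"] by (simp only: enc_eq_iff)
  have ord: "smul m x' \<in> lat" if "f (enc x) = enc x'" "smul m x \<in> lat" for m x x'
    using auto_enc_lat[OF f hom_enc_smul[OF h that(1)]] that(2) by blast
  obtain a1 b1 c1 d1 where v1: "v1 = (a1, b1, c1, d1)" by (cases v1)
  obtain a2' b2 c2 d2 where v2': "v2 = (a2', b2, c2, d2)" by (cases v2)
  obtain a3' b3 c3 d3 where v3': "v3 = (a3', b3, c3, d3)" by (cases v3)
  obtain a4' b4' c4' D where v4': "v4 = (a4', b4', c4', D)" by (cases v4)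
  \<comment> \<open>Orders do not grow under f: this forces q to divide the first entries of v2 and
    v3, and all entries of v4 but the last to vanish modulo \<open>P\<close>.\<close>
  have "smul (P * P) v2 \<in> lat" "smul (P * P) v3 \<in> lat" "smul P v4 \<in> lat"
    by (rule ord[OF v(2)] ord[OF v(3)] ord[OF v(4)], simp add: lat_iff)+
  then have "P * P * q dvd P * P * a2'" "P * P * q dvd P * P * a3'"
      and "P * (P * q) dvd P * a4'" "P * P dvd P * b4'" "P * P dvd P * c4'"
    by (simp_all add: v2' v3' v4' lat_iff mult.assoc)
  then have "q dvd a2'" "q dvd a3'" "P * q dvd a4'" "P dvd b4'" "P dvd c4'"
    using Pq by simp_all
  then obtain a2 a3 a4 b4 c4
    where "a2' = q * a2" "a3' = q * a3" "a4' = P * q * a4" "b4' = P * b4" "c4' = P * c4"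
    by (elim dvdE)
  then have v2: "v2 = (q * a2, b2, c2, d2)" and v3: "v3 = (q * a3, b3, c3, d3)"
      and v4: "v4 = (P * q * a4, P * b4, P * c4, D)"
    by (simp_all add: v2' v3' v4')
  have r12: "P * q * P dvd P * q * (b1 * c2 - c1 * b2 - a2)"
      "P * P dvd P * (a1 * b2 - b1 * (q * a2) + a1 * c2 - c1 * (q * a2) + c1 * d2 - d1 * c2 - b2)"
      "P * P dvd P * (a1 * d2 - d1 * (q * a2) + b1 * d2 - d1 * b2 - c2)"
    using rel[OF v(1) v(2)] by (simp_all add: v1 v2 lat_iff algebra_simps)
  have r13: "P * q * P dvd P * q * (b1 * c3 - c1 * b3 - a2)"
      "P * P dvd P * (a1 * b3 - b1 * (q * a3) + a1 * c3 - c1 * (q * a3) + c1 * d3 - d1 * c3 - b2)"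
      "P * P dvd P * (a1 * d3 - d1 * (q * a3) + b1 * d3 - d1 * b3 - c2)"
    using rel[OF v(1) v(3)] by (simp_all add: v1 v2 v3 lat_iff algebra_simps)
  have r14: "P * q * P dvd P * q * (b1 * P * c4 - c1 * P * b4 - a3)"
      "P * P dvd P * (a1 * P * b4 - b1 * P * q * a4 + a1 * P * c4 - c1 * P * q * a4
        + c1 * D - d1 * P * c4 - b3)"
      "P * P dvd P * (a1 * D - d1 * P * q * a4 + b1 * D - d1 * P * b4 - c3)"
    using rel[OF v(1) v(4)] by (simp_all add: v1 v3 v4 lat_iff algebra_simps)
  have r23: "P * q * P dvd P * q * (b2 * c3 - c2 * b3 - a1)"
    using rel[OF v(2) v(3)] by (simp add: v1 v2 v3 lat_iff algebra_simps)
  have r24: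
      "P * P dvd P * (q * a2 * P * b4 - b2 * P * q * a4 + q * a2 * P * c4 - c2 * P * q * a4
        + c2 * D - d2 * P * c4 - b3)"
      "P * P dvd P * (q * a2 * D - d2 * P * q * a4 + b2 * D - d2 * P * b4 - c3)"
    using rel[OF v(2) v(4)] by (simp_all add: v2 v3 v4 lat_iff algebra_simps)
  have r34: "P * q * P dvd P * q * (b3 * P * c4 - c3 * P * b4 - a2)"
    using rel[OF v(3) v(4)] by (simp add: v2 v3 v4 lat_iff algebra_simps)
  note canc = dvd_cancel_left[OF \<open>P * q > 0\<close>] dvd_cancel_left[OF \<open>P > 0\<close>]
  have mod_P: "P dvd x" if "P dvd x + P * y" for x y
    using that by (metis dvd_add_left_iff dvd_triv_left)
  have e14: "P dvd a3" "P dvd c1 * D - b3" "P dvd a1 * D + b1 * D - c3"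
  proof -
    have "P dvd - a3"
      by (rule mod_P[of _ "b1 * c4 - c1 * b4"]) (use canc(1)[OF r14(1)] in \<open>simp add: algebra_simps\<close>)
    then show "P dvd a3" by simp
    show "P dvd c1 * D - b3"
      by (rule mod_P[of _ "a1 * b4 - b1 * q * a4 + a1 * c4 - c1 * q * a4 - d1 * c4"])
        (use canc(2)[OF r14(2)] in \<open>simp add: algebra_simps\<close>)
    show "P dvd a1 * D + b1 * D - c3"
      by (rule mod_P[of _ "- d1 * q * a4 - d1 * b4"])
        (use canc(2)[OF r14(3)] in \<open>simp add: algebra_simps\<close>)
  qed
  have e24: "P dvd c2 * D - b3" "P dvd q * a2 * D + b2 * D - c3"
  proof -
    show "P dvd c2 * D - b3"
      by (rule mod_P[of _ "q * a2 * b4 - b2 * q * a4 + q * a2 * c4 - c2 * q * a4 - d2 * c4"])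
        (use canc(2)[OF r24(1)] in \<open>simp add: algebra_simps\<close>)
    show "P dvd q * a2 * D + b2 * D - c3"
      by (rule mod_P[of _ "- d2 * q * a4 - d2 * b4"])
        (use canc(2)[OF r24(2)] in \<open>simp add: algebra_simps\<close>)
  qed
  have e34: "P dvd a2"
  proof -
    have "P dvd - a2"
      by (rule mod_P[of _ "b3 * c4 - c3 * b4"]) (use canc(1)[OF r34] in \<open>simp add: algebra_simps\<close>)
    then show ?thesis by simp
  qed
  \<comment> \<open>Preimages play the role of columns of an inverse matrix, and their orders do not
    grow either.\<close>
  have pre: "\<exists>y. lin v1 v2 v3 v4 y - x \<in> rad \<and> (\<forall>m. smul m x \<in> lat \<longrightarrow> smul m y \<in> lat)" for x
  proof -
    obtain y where y: "f (enc y) = enc x" by (rule auto_enc_preimage[OF f])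
    have "smul m y \<in> lat" if "smul m x \<in> lat" for m
      using auto_enc_lat[OF f hom_enc_smul[OF h y, of m]] that by blast
    moreover have "lin v1 v2 v3 v4 y - x \<in> rad"
      using L[of y] y by (intro lat_rad) (simp flip: enc_eq_iff)
    ultimately show ?thesis by blast
  qed
  obtain n1 where n1: "P dvd a1 * n1 - 1"
  proof -
    obtain y where y: "lin v1 v2 v3 v4 y - (1, 0, 0, 0) \<in> rad" using pre by blast
    obtain y1 y2 y3 y4 where "y = (y1, y2, y3, y4)" by (cases y)
    with y have *: "P dvd ((a1 * y1 - 1) + y2 * q * a2 + y3 * q * a3) + P * (y4 * q * a4)"
      by (simp add: v1 v2 v3 v4 rad_iff algebra_simps)
    have "P dvd ((a1 * y1 - 1) + y2 * q * a2 + y3 * q * a3) - y2 * q * a2 - y3 * q * a3"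
      using mod_P[OF *] e14(1) e34 by - (assumption | rule dvd_diff dvd_mult)+
    then show ?thesis using that by simp
  qed
  obtain nD where nD: "P dvd D * nD - 1"
  proof -
    obtain y where y: "lin v1 v2 v3 v4 y - (0, 0, 0, 1) \<in> rad"
        and ord: "\<And>m. smul m (0, 0, 0, 1) \<in> lat \<Longrightarrow> smul m y \<in> lat"
      using pre by blast
    obtain y1 y2 y3 y4 where y_eq: "y = (y1, y2, y3, y4)" by (cases y)
    \<comment> \<open>The preimage of x4 is killed by p^2, so its first three coordinates vanish
      modulo \<open>P\<close> and only D times the last survives.\<close>
    have "smul P y \<in> lat" by (rule ord) (simp add: lat_iff)
    then have "P * (P * q) dvd P * y1" "P * P dvd P * y2" "P * P dvd P * y3"
      by (simp_all add: y_eq lat_iff mult.assoc)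
    then have "P * q dvd y1" "P dvd y2" "P dvd y3" using Pq by simp_all
    then have yP: "P dvd y1" "P dvd y2" "P dvd y3" by (auto dest: dvd_mult_left)
    from y have "P dvd (D * y4 - 1) + d1 * y1 + d2 * y2 + d3 * y3"
      by (simp add: y_eq v1 v2 v3 v4 rad_iff algebra_simps)
    then have "P dvd ((D * y4 - 1) + d1 * y1 + d2 * y2 + d3 * y3) - d1 * y1 - d2 * y2 - d3 * y3"
      using yP by - (assumption | rule dvd_diff dvd_mult)+
    then show ?thesis using that by simp
  qed
  obtain n3 where n3: "P dvd c1 \<Longrightarrow> P dvd c2 \<Longrightarrow> P dvd c3 * n3 - 1"
  proof -
    obtain y where y: "lin v1 v2 v3 v4 y - (0, 0, 1, 0) \<in> rad" using pre by blast
    obtain y1 y2 y3 y4 where "y = (y1, y2, y3, y4)" by (cases y)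
    \<comment> \<open>The x3-coordinate says c1 y1 + c2 y2 + c3 y3 = 1 modulo \<open>P\<close>, so
      c3 is a unit once c1 and c2 vanish.\<close>
    with y have *: "P dvd ((c3 * y3 - 1) + y1 * c1 + y2 * c2) + P * (y4 * c4)"
      by (simp add: v1 v2 v3 v4 rad_iff algebra_simps)
    have "P dvd c3 * y3 - 1" if "P dvd c1" "P dvd c2"
    proof -
      have "P dvd ((c3 * y3 - 1) + y1 * c1 + y2 * c2) - y1 * c1 - y2 * c2"
        using that mod_P[OF *] by - (assumption | rule dvd_diff dvd_mult)+
      then show ?thesis by simp
    qed
    then show ?thesis by (rule that)
  qed
  note R = rigid_matrix[OF canc(1)[OF r12(1)] canc(2)[OF r12(2)] canc(2)[OF r12(3)]
    canc(1)[OF r13(1)] canc(2)[OF r13(2)] canc(2)[OF r13(3)]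
    e14 canc(1)[OF r23] e24 e34 n1 nD n3]
  show "v1 - (1, 0, 0, 0) \<in> rad" using R by (simp add: v1 rad_iff)
  show "v2 - (0, 1, 0, 0) \<in> com" using R e34 by (simp add: v2 com_iff mult.commute mult_dvd_mono)
  show "v3 - (0, 0, 1, 0) \<in> com" using R e14(1) by (simp add: v3 com_iff mult.commute mult_dvd_mono)
  show "v4 - (0, 0, 0, 1) \<in> com" using R by (simp add: v4 com_iff)
qed


subsection \<open>Central automorphisms\<close>

lemma smul_rad_lat:
  assumes a: "P * q dvd a" and r: "r \<in> rad"
  shows "smul a r \<in> lat"
proof (cases r)
  case (fields r1 r2 r3 r4)
  have "P dvd r1" "P dvd r2" "P dvd r3" "P dvd r4"
    using r by (simp_all add: fields rad_iff)
  moreover have "P dvd a" using a by (rule dvd_mult_left)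
  ultimately show ?thesis
    using mult_dvd_mono[OF a, of P r1] by (simp add: fields lat_iff mult_dvd_mono algebra_simps)
qed

lemma smul_com_lat:
  assumes b: "P dvd b" and u: "u \<in> com"
  shows "smul b u \<in> lat"
proof (cases u)
  case (fields u1 u2 u3 u4)
  have "P * q dvd u1" "P dvd u2" "P dvd u3" "P dvd u4"
    using u by (simp_all add: fields com_iff)
  then show ?thesis
    using b by (simp add: fields lat_iff mult_dvd_mono mult.assoc)
qed

definition shift :: "int4 \<Rightarrow> int4 \<Rightarrow> int4 \<Rightarrow> int4 \<Rightarrow> int4 \<Rightarrow> int4" where
  "shift r u v w x = x + lin r u v w x"

text \<open>The map id + h, restricted because members of \<open>auto\<close> are extensional on the
  carrier.\<close>

definition central_auto :: "int4 \<Rightarrow> int4 \<Rightarrow> int4 \<Rightarrow> int4 \<Rightarrow> nat \<Rightarrow> nat" where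
  "central_auto r u v w = (\<lambda>g\<in>carrier G. enc (shift r u v w (from_nat g)))"

text \<open>The columns of a homomorphism h from the abelianization to the center. There x1 has
  order p^(n-2), which kills the whole center; x2, x3, x4 have order p^2, and the central elements
  killed by p^2 are those of \<open>com\<close>.\<close>

definition admissible :: "int4 \<Rightarrow> int4 \<Rightarrow> int4 \<Rightarrow> int4 \<Rightarrow> bool" where
  "admissible r u v w \<longleftrightarrow> r \<in> rad \<and> u \<in> com \<and> v \<in> com \<and> w \<in> com"

text \<open>First coordinates in \<open>com\<close> are multiples of \<open>P * q\<close> and kill
  \<open>rad\<close>; the others are multiples of \<open>P\<close> and kill \<open>com\<close>. Thus
  h factors through the abelianization.\<close>

lemma lin_com_lat:
  assumes "admissible r u v w" "x \<in> com"
  shows "lin r u v w x \<in> lat"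
proof (cases x)
  case (fields a b c d)
  then show ?thesis
    using assms by (simp add: admissible_def com_iff add_lat smul_rad_lat smul_com_lat)
qed

lemma rad_smul: "x \<in> rad \<Longrightarrow> smul m x \<in> rad"
  by (cases x) (simp add: rad_iff)

lemma com_smul: "x \<in> com \<Longrightarrow> smul m x \<in> com"
  by (cases x) (simp add: com_iff)

lemma lin_rad: "admissible r u v w \<Longrightarrow> lin r u v w x \<in> rad"
  by (cases x) (simp add: admissible_def rad_add rad_smul com_rad)

lemma shift_add: "shift r u v w (x + y) = shift r u v w x + shift r u v w y"
  by (simp add: shift_def lin_add algebra_simps)

lemma shift_lat: "admissible r u v w \<Longrightarrow> x \<in> lat \<Longrightarrow> shift r u v w x \<in> lat"
  by (simp add: shift_def add_lat lin_com_lat lat_com)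

lemma central_auto_enc:
  assumes "admissible r u v w"
  shows "central_auto r u v w (enc x) = enc (shift r u v w x)"
proof -
  have "shift r u v w (red x - x) \<in> lat"
    by (rule shift_lat[OF assms red_diff_lat])
  moreover have "shift r u v w (red x - x) = shift r u v w (red x) - shift r u v w x"
    using shift_add[of r u v w "red x - x" x] by simp
  ultimately have "enc (shift r u v w (red x)) = enc (shift r u v w x)"
    by (simp add: enc_eq_iff)
  then show ?thesis
    by (simp add: central_auto_def) (simp add: enc_def)
qed

text \<open>Injectivity of id + h: since h takes values in \<open>rad\<close>, x is in
  \<open>rad\<close>, so u, v and w contribute nothing. What is left is x + a r, and 1 + r1 is prime
  to p.\<close>

lemma shift_lat_imp:
  assumes adm: "admissible r u v w" and x: "shift r u v w x \<in> lat"
  shows "x \<in> lat"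
proof -
  have "shift r u v w x + - lin r u v w x \<in> rad"
    by (intro rad_add rad_minus lin_rad[OF adm] lat_rad x)
  then have xr: "x \<in> rad" by (simp add: shift_def)
  obtain a b c d where abcd: "x = (a, b, c, d)" by (cases x)
  obtain r1 r2 r3 r4 where r: "r = (r1, r2, r3, r4)" by (cases r)
  have "smul b u + smul c v + smul d w \<in> lat"
    using adm xr by (intro add_lat smul_com_lat) (simp_all add: abcd rad_iff admissible_def)
  from diff_lat[OF x this] have "(a, b, c, d) + smul a r \<in> lat"
    by (simp add: shift_def abcd algebra_simps)
  then have *: "P * P * q dvd a * (1 + r1)" "P * P dvd b + a * r2" "P * P dvd c + a * r3" "P dvd d + a * r4"
    by (simp_all add: r lat_iff algebra_simps)
  have r_P: "P dvd r1" "P dvd r2" "P dvd r3" "P dvd r4"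
    using adm by (simp_all add: admissible_def r rad_iff)
  have "coprime P (1 + r1)"
  proof -
    obtain s where "r1 = P * s" using r_P by (elim dvdE)
    then have "coprime P (P * s + 1)" by (metis coprime_1_right coprime_iff_gcd_eq_1 gcd_add_mult mult.commute)
    then show ?thesis using \<open>r1 = P * s\<close> by (simp add: add.commute)
  qed
  then have "coprime (P * P * q) (1 + r1)"
    by (simp add: P_def q_def)
  then have a: "P * P * q dvd a" using *(1) by (simp add: coprime_dvd_mult_left_iff)
  then have "P * P dvd a" by (rule dvd_mult_left)
  then have "P * P dvd b" "P * P dvd c"
    using *(2,3) by (simp_all add: dvd_add_left_iff dvd_mult2)
  moreover have "P dvd d"
    using *(4) r_P(4) by (simp add: dvd_add_left_iff)
  ultimately show ?thesis using a by (simp add: abcd lat_iff)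
qed

lemma central_auto_auto:
  assumes adm: "admissible r u v w"
  shows "central_auto r u v w \<in> auto G"
proof -
  let ?f = "central_auto r u v w"
  have into: "?f \<in> carrier G \<rightarrow> carrier G"
    by (auto simp: carrier_G central_auto_enc[OF adm])
  have "?f (enc x \<otimes>\<^bsub>G\<^esub> enc y) = ?f (enc x) \<otimes>\<^bsub>G\<^esub> ?f (enc y)" for x y
  proof -
    \<comment> \<open>h kills values of B, and B vanishes on values of h, so the discrepancy lies in
      \<open>lat\<close>.\<close>
    have "shift r u v w (x + y + bil x y)
        - (shift r u v w x + shift r u v w y + bil (shift r u v w x) (shift r u v w y))
      = lin r u v w (bil x y) - bil (lin r u v w x) y - bil (shift r u v w x) (lin r u v w y)"
      by (simp add: shift_add) (simp add: shift_def bil_add_left bil_add_right)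
    also have "\<dots> \<in> lat"
      by (intro diff_lat bil_rad_lat bil_rad_lat' lin_rad adm lin_com_lat bil_com)
    finally show ?thesis
      by (simp add: mult_enc central_auto_enc[OF adm] enc_eq_iff)
  qed
  then have hom: "?f \<in> hom G G"
    using into by (auto simp only: hom_def carrier_G mem_Collect_eq ball_simps)
  have "inj_on ?f (carrier G)"
  proof (rule inj_onI)
    fix g h assume gh: "g \<in> carrier G" "h \<in> carrier G" "?f g = ?f h"
    then obtain x y where xy: "g = enc x" "h = enc y" by (meson enc_exhaust)
    with gh have "shift r u v w x - shift r u v w y \<in> lat"
      by (simp add: central_auto_enc[OF adm] enc_eq_iff)
    moreover have "shift r u v w (x - y) = shift r u v w x - shift r u v w y"
      using shift_add[of r u v w "x - y" y] by simp
    ultimately have "x - y \<in> lat"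
      by (simp only: shift_lat_imp[OF adm])
    then show "g = h" by (simp add: xy enc_eq_iff)
  qed
  moreover have "?f ` carrier G \<subseteq> carrier G" using into by blast
  ultimately have "bij_betw ?f (carrier G) (carrier G)"
    using endo_inj_surj[OF finite_G] by (auto simp: bij_betw_def)
  then show ?thesis
    using hom by (simp add: auto_def Bij_def central_auto_def)
qed

lemma auto_central:
  assumes f: "f \<in> auto G"
    and v: "f (enc (1, 0, 0, 0)) = enc v1" "f (enc (0, 1, 0, 0)) = enc v2"
      "f (enc (0, 0, 1, 0)) = enc v3" "f (enc (0, 0, 0, 1)) = enc v4"
  shows "admissible (v1 - (1, 0, 0, 0)) (v2 - (0, 1, 0, 0)) (v3 - (0, 0, 1, 0)) (v4 - (0, 0, 0, 1))"
    and "f = central_auto (v1 - (1, 0, 0, 0)) (v2 - (0, 1, 0, 0)) (v3 - (0, 0, 1, 0)) (v4 - (0, 0, 0, 1))"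
proof -
  show adm: "admissible (v1 - (1, 0, 0, 0)) (v2 - (0, 1, 0, 0)) (v3 - (0, 0, 1, 0)) (v4 - (0, 0, 0, 1))"
    using auto_rigid[OF f v] by (simp add: admissible_def)
  have h: "f \<in> hom G G" using f by (simp add: auto_def)
  show "f = central_auto (v1 - (1, 0, 0, 0)) (v2 - (0, 1, 0, 0)) (v3 - (0, 0, 1, 0)) (v4 - (0, 0, 0, 1))"
  proof (rule extensionalityI[of _ "carrier G"])
    show "f \<in> extensional (carrier G)" using f by (simp add: auto_def Bij_def)
    fix g assume "g \<in> carrier G"
    then obtain x where x: "g = enc x" by (rule enc_exhaust)
    obtain a b c d where abcd: "x = (a, b, c, d)" by (cases x)
    have "lin v1 v2 v3 v4 x
        = shift (v1 - (1, 0, 0, 0)) (v2 - (0, 1, 0, 0)) (v3 - (0, 0, 1, 0)) (v4 - (0, 0, 0, 1)) x"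
      by (cases v1; cases v2; cases v3; cases v4) (simp add: abcd shift_def algebra_simps)
    then show "f g = central_auto (v1 - (1, 0, 0, 0)) (v2 - (0, 1, 0, 0)) (v3 - (0, 0, 1, 0))
        (v4 - (0, 0, 0, 1)) g"
      unfolding x central_auto_enc[OF adm] hom_enc_lin[OF h v] by simp
  qed (simp add: central_auto_def)
qed

lemma auto_images:
  assumes "f \<in> auto G"
  obtains v1 v2 v3 v4 where "f (enc (1, 0, 0, 0)) = enc v1" "f (enc (0, 1, 0, 0)) = enc v2"
    "f (enc (0, 0, 1, 0)) = enc v3" "f (enc (0, 0, 0, 1)) = enc v4"
proof -
  have "f (enc x) \<in> carrier G" for x
    using assms hom_in_carrier[of f G G] by (simp add: auto_def)
  then show ?thesis using that by (meson enc_exhaust)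
qed

lemma auto_obtain:
  assumes "f \<in> auto G"
  obtains r u v w where "admissible r u v w" "f = central_auto r u v w"
  using auto_images[OF assms] auto_central[OF assms] by metis

section \<open>Commutativity of the automorphism group\<close>

lemma lin_lin_commute:
  assumes adm: "admissible r u v w" and adm': "admissible r' u' v' w'"
  shows "lin r u v w (lin r' u' v' w' x) - lin r' u' v' w' (lin r u v w x) \<in> lat"
proof -
  obtain a b c d where x: "x = (a, b, c, d)" by (cases x)
  obtain r1 r2 r3 r4 where r: "r = (r1, r2, r3, r4)" by (cases r)
  obtain s1 s2 s3 s4 where r': "r' = (s1, s2, s3, s4)" by (cases r')
  have P_r: "P dvd r1" "P dvd r2" "P dvd r3" "P dvd r4" "P dvd s1" "P dvd s2" "P dvd s3" "P dvd s4"
    using adm adm' by (simp_all add: admissible_def r r' rad_iff)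
  \<comment> \<open>The part of h'(x) built from u', v', w' lies in \<open>com\<close> and is killed
    by h; s2, s3, s4 are multiples of \<open>P\<close> and kill u, v, w. Only the s1 term
    survives.\<close>
  have red: "lin r u v w (lin r' u' v' w' x) - smul (a * s1) r \<in> lat"
    if adm: "admissible r u v w" and adm': "admissible r' u' v' w'" and r': "r' = (s1, s2, s3, s4)"
    for r u v w r' u' v' w' s1 s2 s3 s4
  proof -
    have "lin r u v w (lin r' u' v' w' x) - smul (a * s1) r
        = lin r u v w (smul b u' + smul c v' + smul d w')
          + (smul (a * s2) u + smul (a * s3) v + smul (a * s4) w)"
      by (simp add: x r' lin_add add.assoc)
    also have "\<dots> \<in> lat"
    proof (rule add_lat)
      show "lin r u v w (smul b u' + smul c v' + smul d w') \<in> lat"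
        using adm' by (intro lin_com_lat[OF adm] com_add com_smul) (simp_all add: admissible_def)
      show "smul (a * s2) u + smul (a * s3) v + smul (a * s4) w \<in> lat"
        using adm adm' by (intro add_lat smul_com_lat dvd_mult) (simp_all add: admissible_def r' rad_iff)
    qed
    finally show ?thesis .
  qed
  \<comment> \<open>The first coordinates agree; the second and third are built from products of two
    multiples of p^2, and the fourth is a multiple of p^2.\<close>
  have "smul (a * s1) r - smul (a * r1) r' \<in> lat"
  proof -
    have "P * P dvd s1 * r2" "P * P dvd r1 * s2" "P * P dvd s1 * r3" "P * P dvd r1 * s3"
      using P_r by (simp_all add: mult_dvd_mono)
    then have "P * P dvd a * (s1 * r2) - a * (r1 * s2)" "P * P dvd a * (s1 * r3) - a * (r1 * s3)"
      by (simp_all only: dvd_diff dvd_mult)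
    then show ?thesis
      using P_r by (simp add: r r' lat_iff ac_simps)
  qed
  from add_lat[OF diff_lat[OF red[OF adm adm' r'] red[OF adm' adm r]] this]
  show ?thesis by (simp add: algebra_simps)
qed

lemma comm_group_AutoGroup: "comm_group (AutoGroup G)"
proof (rule group.group_comm_groupI[OF AutoGroup])
  fix f g assume "f \<in> carrier (AutoGroup G)" "g \<in> carrier (AutoGroup G)"
  then have fg: "f \<in> auto G" "g \<in> auto G" by (simp_all add: AutoGroup_def)
  obtain r u v w where adm: "admissible r u v w" and f: "f = central_auto r u v w"
    by (rule auto_obtain[OF fg(1)])
  obtain r' u' v' w' where adm': "admissible r' u' v' w'" and g: "g = central_auto r' u' v' w'"
    by (rule auto_obtain[OF fg(2)])
  have "f (g (enc x)) = g (f (enc x))" for x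
    unfolding f g central_auto_enc[OF adm] central_auto_enc[OF adm']
  proof (rule enc_eqI)
    have "shift r u v w (shift r' u' v' w' x) - shift r' u' v' w' (shift r u v w x)
        = lin r u v w (lin r' u' v' w' x) - lin r' u' v' w' (lin r u v w x)"
      by (simp add: shift_def lin_add)
    also have "\<dots> \<in> lat" by (rule lin_lin_commute[OF adm adm'])
    finally show "shift r u v w (shift r' u' v' w' x) - shift r' u' v' w' (shift r u v w x) \<in> lat" .
  qed
  then have "compose (carrier G) f g = compose (carrier G) g f"
    unfolding compose_def by (intro restrict_ext) (metis enc_exhaust)
  then show "f \<otimes>\<^bsub>AutoGroup G\<^esub> g = g \<otimes>\<^bsub>AutoGroup G\<^esub> f"
    using fg by (simp add: AutoGroup_def BijGroup_def auto_def)
qed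

section \<open>Counting the automorphisms\<close>

text \<open>One count serves \<open>rad\<close> (s = P) and \<open>com\<close> (s = P q): modulo
  \<open>lat\<close>, multiples of s give t classes, b and c give \<open>P\<close> classes each, and
  d gives only one.\<close>

lemma card_coset:
  fixes s t :: int
  assumes st: "P * P * q = s * t" and t: "t > 0"
  shows "card (enc ` (+) e ` {(a, b, c, d). s dvd a \<and> P dvd b \<and> P dvd c \<and> P dvd d}) = nat (t * P * P)"
proof -
  have nz: "s \<noteq> 0" "P \<noteq> 0" using st P_pos q_pos by auto
  define h where "h = (\<lambda>(a, b, c). enc (e + (s * a, P * b, P * c, 0)))"
  let ?B = "{0..<t} \<times> {0..<P} \<times> {0..<P}"
  \<comment> \<open>The right side is an arbitrary coset element: d' = 0 yields injectivity, and
    general d' reduces any element to the box.\<close>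
  have h_eq: "h (a, b, c) = enc (e + (s * a', P * b', P * c', P * d')) \<longleftrightarrow>
      a mod t = a' mod t \<and> b mod P = b' mod P \<and> c mod P = c' mod P" for a b c a' b' c' d'
  proof -
    have "s * t dvd s * a - s * a' \<longleftrightarrow> t dvd a - a'"
      using nz by (simp flip: right_diff_distrib)
    moreover have "P * P dvd P * y - P * y' \<longleftrightarrow> P dvd y - y'" for y y'
      using nz by (simp flip: right_diff_distrib)
    ultimately show ?thesis
      by (simp add: h_def enc_eq_iff lat_iff st mod_eq_dvd_iff)
  qed
  have inj: "inj_on h ?B"
  proof (rule inj_onI)
    fix y y' assume y: "y \<in> ?B" "y' \<in> ?B" and eq: "h y = h y'"
    obtain a b c a' b' c' where abc: "y = (a, b, c)" "y' = (a', b', c')" by (cases y; cases y')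
    from eq have "h (a, b, c) = enc (e + (s * a', P * b', P * c', P * 0))" by (simp add: abc h_def)
    then show "y = y'" using y unfolding h_eq by (simp add: abc)
  qed
  have "enc ` (+) e ` {(a, b, c, d). s dvd a \<and> P dvd b \<and> P dvd c \<and> P dvd d} = h ` ?B"
  proof (intro equalityI subsetI)
    fix z assume "z \<in> enc ` (+) e ` {(a, b, c, d). s dvd a \<and> P dvd b \<and> P dvd c \<and> P dvd d}"
    then obtain a b c d where z: "z = enc (e + (a, b, c, d))" "s dvd a" "P dvd b" "P dvd c" "P dvd d"
      by blast
    obtain a' b' c' d' where "a = s * a'" "b = P * b'" "c = P * c'" "d = P * d'"
      using z(2-5) by (elim dvdE)
    then have "h (a' mod t, b' mod P, c' mod P) = z"
      unfolding z(1) by (simp only: h_eq mod_mod_trivial)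
    moreover have "(a' mod t, b' mod P, c' mod P) \<in> ?B" using t P_pos by simp
    ultimately show "z \<in> h ` ?B" by blast
  next
    fix z assume "z \<in> h ` ?B"
    then obtain a b c where "z = enc (e + (s * a, P * b, P * c, 0))"
      by (auto simp: h_def)
    moreover have "(s * a, P * b, P * c, 0) \<in> {(a, b, c, d). s dvd a \<and> P dvd b \<and> P dvd c \<and> P dvd d}"
      by simp
    ultimately show "z \<in> enc ` (+) e ` {(a, b, c, d). s dvd a \<and> P dvd b \<and> P dvd c \<and> P dvd d}"
      by blast
  qed
  then have "card (enc ` (+) e ` {(a, b, c, d). s dvd a \<and> P dvd b \<and> P dvd c \<and> P dvd d}) = card ?B"
    using inj by (simp only: card_image)
  also have "\<dots> = nat (t * P * P)"
    using t P_pos by (simp add: card_cartesian_product nat_mult_distrib)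
  finally show ?thesis .
qed

text \<open>An automorphism is determined by the images of the four generators. These vary
  independently over one coset of \<open>rad\<close> and three of \<open>com\<close>, of sizes P^3 q
  and P^3, which makes P^12 q in all.\<close>

lemma order_AutoGroup: "order (AutoGroup G) = p ^ (k + 24)"
proof -
  let ?e1 = "(1, 0, 0, 0) :: int4" and ?e2 = "(0, 1, 0, 0) :: int4"
    and ?e3 = "(0, 0, 1, 0) :: int4" and ?e4 = "(0, 0, 0, 1) :: int4"
  let ?A = "enc ` (+) ?e1 ` rad \<times> enc ` (+) ?e2 ` com \<times> enc ` (+) ?e3 ` com \<times> enc ` (+) ?e4 ` com"
  define \<theta> where "\<theta> f = (f (enc ?e1), f (enc ?e2), f (enc ?e3), f (enc ?e4))" for f :: "nat \<Rightarrow> nat"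
  have "inj_on \<theta> (auto G)"
  proof (rule inj_onI)
    fix f g assume fg: "f \<in> auto G" "g \<in> auto G" "\<theta> f = \<theta> g"
    obtain v1 v2 v3 v4 where v: "f (enc ?e1) = enc v1" "f (enc ?e2) = enc v2"
        "f (enc ?e3) = enc v3" "f (enc ?e4) = enc v4"
      by (rule auto_images[OF fg(1)])
    then have "g (enc ?e1) = enc v1" "g (enc ?e2) = enc v2"
        "g (enc ?e3) = enc v3" "g (enc ?e4) = enc v4"
      using fg(3) by (simp_all add: \<theta>_def)
    then show "f = g"
      using auto_central(2)[OF fg(1) v] auto_central(2)[OF fg(2)] by metis
  qed
  moreover have "\<theta> ` auto G = ?A"
  proof (intro equalityI subsetI)
    fix z assume "z \<in> \<theta> ` auto G"
    then obtain f where f: "f \<in> auto G" "z = \<theta> f" by auto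
    obtain v1 v2 v3 v4 where v: "f (enc ?e1) = enc v1" "f (enc ?e2) = enc v2"
        "f (enc ?e3) = enc v3" "f (enc ?e4) = enc v4"
      by (rule auto_images[OF f(1)])
    have "enc v \<in> enc ` (+) e ` S" if "v - e \<in> S" for v e S
    proof -
      have "v = e + (v - e)" by simp
      then show ?thesis using that by blast
    qed
    then show "z \<in> ?A"
      using auto_rigid[OF f(1) v] by (simp only: f(2) \<theta>_def v mem_Times_iff fst_conv snd_conv)
  next
    fix z assume "z \<in> ?A"
    then obtain r u v w where z: "z = (enc (?e1 + r), enc (?e2 + u), enc (?e3 + v), enc (?e4 + w))"
        and adm: "admissible r u v w"
      unfolding admissible_def by blast
    have "\<theta> (central_auto r u v w) = z"
      unfolding \<theta>_def z central_auto_enc[OF adm] by (simp add: shift_def)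
    then show "z \<in> \<theta> ` auto G" using central_auto_auto[OF adm] by blast
  qed
  ultimately have "card (auto G) = card ?A" using card_image by metis
  moreover have "card (enc ` (+) e ` rad) = nat (P * q * P * P)" for e
    unfolding rad_def by (rule card_coset) (use P_pos q_pos in \<open>simp_all add: mult.assoc\<close>)
  moreover have "card (enc ` (+) e ` com) = nat (P * P * P)" for e
    unfolding com_def by (rule card_coset) (use P_pos in \<open>simp_all add: ac_simps\<close>)
  ultimately have "card (auto G)
      = nat (P * q * P * P) * (nat (P * P * P) * (nat (P * P * P) * nat (P * P * P)))"
    by (simp only: card_cartesian_product)
  also have "\<dots> = nat (P ^ 12 * q)"
    using P_pos q_pos by (simp add: eval_nat_numeral algebra_simps flip: nat_mult_distrib)
  also have "P ^ 12 * q = int (p ^ (k + 24))"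
    by (simp add: P_def q_def power_add flip: power_mult)
  finally show ?thesis
    by (simp add: order_def AutoGroup_def del: of_nat_power)
qed

end

theorem theoremA:
  fixes n p :: nat
  assumes "n \<ge> 4" and "Factorial_Ring.prime p" and "odd p"
  shows "\<exists>G :: nat monoid.
    group G \<and> order G = p ^ (n + 10) \<and> group_exponent G = p ^ n \<and>
    (n = 4 \<longrightarrow>
       derived G (carrier G) = group_center G \<and>
       proper_subgroup_in G (group_center G) (frattini G) \<and>
       comm_group (AutoGroup G)) \<and>
    (n \<ge> 5 \<longrightarrow>
       proper_subgroup_in G (derived G (carrier G)) (group_center G) \<and>
       proper_subgroup_in G (group_center G) (frattini G) \<and>
       comm_group (AutoGroup G)) \<and>
    order (AutoGroup G) = p ^ (n + 20)"
proof -
  obtain k where n: "n = k + 4" using assms(1) by (metis add.commute le_Suc_ex)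
  interpret odd_prime_group p k using assms by unfold_locales
  have kn: "k + 14 = n + 10" "k + 4 = n" "k + 24 = n + 20" using n by simp_all
  have "derived G (carrier G) = group_center G" if "n = 4"
    by (rule derived_eq_center) (use n that in simp)
  moreover have "proper_subgroup_in G (derived G (carrier G)) (group_center G)" if "n \<ge> 5"
    by (rule derived_center) (use n that in simp)
  ultimately show ?thesis
    using group_G order_G exponent_G center_frattini comm_group_AutoGroup order_AutoGroup
    unfolding kn by blast
qed

end
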